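(* Let $\mathcal{L}$ be a lattice of rank $2$ in $\mathbb{Z}^3$. Then $\mathcal{L}$ is homogeneous if and only if $\mathcal{L}$ is generated by the columns of a ($3\times 3$) CB matrix.
   Context: A lattice is a subgroup of $\mathbb{Z}^3$; it is homogeneous if there is a vector $\mathbf{d}=(d_1,d_2,d_3)$ of positive integers with $d_1a_1+d_2a_2+d_3a_3=0$ for all $a=(a_1,a_2,a_3)\in\mathcal{L}$ (equivalently, its lattice ideal is homogeneous with respect to the weights $\deg t_i=d_i$). A $3\times3$ CB (critical binomial) matrix is an integer matrix $L$ with positive diagonal entries, non-positive off-diagonal entries, at least one non-zero off-diagonal entry in each column, and $L\mathbf{1}^\top=0$, where $\mathbf{1}=(1,1,1)$. *)

theory Defs
  imports "HOL-Analysis.Analysis" "HOL-Computational_Algebra.Group_Closure"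
begin

interpretation int_vec: module "(*s) :: int \<Rightarrow> int ^ 'n::finite \<Rightarrow> int ^ 'n"
  by unfold_locales (simp_all add: vec_eq_iff algebra_simps)

definition lattice_in :: "(int ^ 'n::finite) set \<Rightarrow> bool" where
  "lattice_in L \<longleftrightarrow> 0 \<in> L \<and> (\<forall>a\<in>L. \<forall>b\<in>L. a + b \<in> L) \<and> (\<forall>a\<in>L. - a \<in> L)"

(* A Z-basis: linearly independent over the integers and generating L as an abelian group
   (group_closure S is the subgroup generated by S). *)
definition lattice_basis :: "(int ^ 'n::finite) set \<Rightarrow> (int ^ 'n) set \<Rightarrow> bool" where
  "lattice_basis B L \<longleftrightarrow> int_vec.independent B \<and> group_closure B = L"

(* The rank of a free abelian group is the common cardinality of its bases. Subgroups of Z^n are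
   free of finite rank, so the else-branch is not reached when L is a lattice; the shape
   follows the library definition of dim. *)
definition lattice_rank :: "(int ^ 'n::finite) set \<Rightarrow> nat" where
  "lattice_rank L =
     (if \<exists>B. lattice_basis B L then card (SOME B. lattice_basis B L) else 0)"

definition homogeneous_lattice :: "(int ^ 'n::finite) set \<Rightarrow> bool" where
  "homogeneous_lattice L \<longleftrightarrow>
     (\<exists>d :: int ^ 'n. (\<forall>i. d $ i > 0) \<and> (\<forall>a\<in>L. (\<Sum>i\<in>UNIV. d $ i * a $ i) = 0))"

(* A $ i $ j is the entry in row i and column j; 1 is the all-ones vector, so the last
   condition says that the row sums of A vanish. *)
definition CB_matrix :: "int ^ 'n::finite ^ 'n \<Rightarrow> bool" where
  "CB_matrix A \<longleftrightarrow>
     (\<forall>i. A $ i $ i > 0) \<and>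
     (\<forall>i j. i \<noteq> j \<longrightarrow> A $ i $ j \<le> 0) \<and>
     (\<forall>j. \<exists>i. i \<noteq> j \<and> A $ i $ j \<noteq> 0) \<and>
     A *v 1 = 0"

end

(* A CB matrix is the Laplacian of a weighted digraph on three vertices, so its left kernel contains
   the vector whose entries are the total weights of the spanning trees rooted at the three
   vertices; the sign conditions make this vector positive.

   Conversely, let d > 0 annihilate L. One looks for a basis (u, v) of L whose sign patterns are
   (+,-,-) and (-,+,-), and such that u + v has non-negative first and second entries; then
   u, v, -(u + v) are the columns of a CB matrix. The Euclidean algorithm on third entries, followed
   by subtracting a large multiple, provides the sign patterns. If an entry of u + v has the wrong
   sign, replacing v by u + v (or u by u + v) preserves the patterns, because d forces any non-zero
   vector with two non-positive entries to have a positive third one, and it decreases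
   |u_2| + |v_1|. *)
theory Submission
  imports Defs
begin

section \<open>Generated subgroups, and elementary operations on bases of two vectors\<close>

lemma group_closure_subset:
  assumes "S \<subseteq> group_closure T"
  shows "group_closure S \<subseteq> group_closure T"
proof
  fix x assume "x \<in> group_closure S"
  then show "x \<in> group_closure T"
    by induction (use assms in \<open>auto intro: group_closure.diff\<close>)
qed

lemma group_closure_vector_scalar_mult:
  fixes x :: "int ^ 'n"
  assumes "x \<in> group_closure S"
  shows "k *s x \<in> group_closure S"
proof -
  have nat: "int n *s x \<in> group_closure S" for n
    by (induction n) (auto simp: vector_sadd_rdistrib intro: group_closure_add assms)
  show ?thesis
  proof (cases "k \<ge> 0")
    case True
    then show ?thesis using nat[of "nat k"] by simp
  next
    case False
    then have "k *s x = - (int (nat (- k)) *s x)" by (simp add: vec_eq_iff)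
    then show ?thesis using nat by (metis group_closure_minus_iff)
  qed
qed

text \<open>An ordered form of \<open>lattice_basis\<close> for two vectors, so that a sign pattern
  can be tied to each of them and the basis changed one vector at a time.\<close>

definition basis_pair :: "(int ^ 'n::finite) set \<Rightarrow> int ^ 'n \<Rightarrow> int ^ 'n \<Rightarrow> bool" where
  "basis_pair L u v \<longleftrightarrow> L = group_closure {u, v} \<and>
     (\<forall>m n. m *s u + n *s v = 0 \<longrightarrow> m = 0 \<and> n = 0)"

lemma basis_pair_commute: "basis_pair L u v \<longleftrightarrow> basis_pair L v u"
  unfolding basis_pair_def by (metis add.commute insert_commute)

lemma basis_pair_mem:
  assumes "basis_pair L u v"
  shows "u \<in> L" "v \<in> L" "u + v \<in> L"
  using assms by (auto simp: basis_pair_def intro: group_closure_add group_closure.base)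

lemma basis_pair_nonzero:
  assumes "basis_pair L u v"
  shows "u \<noteq> 0" "v \<noteq> 0" "u + v \<noteq> 0"
proof -
  have ind: "m *s u + n *s v = 0 \<Longrightarrow> m = 0 \<and> n = 0" for m n
    using assms by (auto simp: basis_pair_def)
  show "u \<noteq> 0" using ind[of 1 0] by auto
  show "v \<noteq> 0" using ind[of 0 1] by auto
  show "u + v \<noteq> 0" using ind[of 1 1] by auto
qed

lemma basis_pair_uminus:
  assumes "basis_pair L u v"
  shows "basis_pair L (- u) v"
proof -
  have "group_closure {- u, v} = group_closure {u, v}"
  proof (rule antisym; rule group_closure_subset)
    have "u \<in> group_closure {- u, v}"
      using group_closure_minus_iff[of u "{- u, v}"] group_closure.base[of "- u" "{- u, v}"] by simp
    then show "{u, v} \<subseteq> group_closure {- u, v}" by (auto intro: group_closure.base)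
  qed (auto intro: group_closure.base)
  moreover have "m = 0 \<and> n = 0" if "m *s (- u) + n *s v = 0" for m n
  proof -
    have "(- m) *s u + n *s v = 0" using that by (simp add: vec_eq_iff)
    then show ?thesis using assms unfolding basis_pair_def by (metis neg_equal_0_iff_equal)
  qed
  ultimately show ?thesis using assms by (auto simp: basis_pair_def)
qed

lemma basis_pair_add_multiple:
  assumes "basis_pair L u v"
  shows "basis_pair L u (v + k *s u)"
proof -
  have mult: "k *s u \<in> group_closure (insert u S)" for S
    by (intro group_closure_vector_scalar_mult group_closure.base) simp
  have "group_closure {u, v + k *s u} = group_closure {u, v}"
  proof (rule antisym; rule group_closure_subset)
    show "{u, v + k *s u} \<subseteq> group_closure {u, v}"
      by (auto intro!: group_closure_add mult intro: group_closure.base)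
    have "(v + k *s u) - k *s u \<in> group_closure {u, v + k *s u}"
      by (intro group_closure.diff mult) (auto intro: group_closure.base)
    then show "{u, v} \<subseteq> group_closure {u, v + k *s u}"
      by (auto intro: group_closure.base)
  qed
  moreover have "m = 0 \<and> n = 0" if "m *s u + n *s (v + k *s u) = 0" for m n
  proof -
    have "(m + n * k) *s u + n *s v = 0" using that by (simp add: vec_eq_iff algebra_simps)
    then have "m + n * k = 0 \<and> n = 0" using assms unfolding basis_pair_def by blast
    then show ?thesis by auto
  qed
  ultimately show ?thesis using assms by (auto simp: basis_pair_def)
qed

lemma basis_pair_add:
  assumes "basis_pair L u v"
  shows "basis_pair L u (u + v)" "basis_pair L (u + v) v"
  using basis_pair_add_multiple[OF assms, of 1] basis_pair_commute
    basis_pair_add_multiple[of L v u 1] assms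
  by (auto simp: add.commute)

section \<open>Bases of a lattice of rank 2, and the Euclidean algorithm on one coordinate\<close>

lemma lattice_rank_2_basis_pair:
  assumes "lattice_rank L = 2"
  obtains u v where "basis_pair L u v"
proof -
  define B where "B = (SOME B. lattice_basis B L)"
  \<comment> \<open>The else-branch of \<open>lattice_rank\<close> has value 0, so rank 2 guarantees
    that a basis exists and that \<open>SOME\<close> picks one.\<close>
  have ex: "\<exists>B. lattice_basis B L" and card: "card B = 2"
    using assms by (auto simp: lattice_rank_def B_def split: if_splits)
  have B: "lattice_basis B L" using someI_ex[OF ex] by (simp add: B_def)
  obtain u v where uv: "B = {u, v}" "u \<noteq> v" using card by (auto simp: card_2_iff)
  have "m = 0 \<and> n = 0" if "m *s u + n *s v = 0" for m n
  proof -
    \<comment> \<open>As \<open>u\<close> and \<open>v\<close> differ, the two coefficients can be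
      read as one function on \<open>B\<close>.\<close>
    define f where "f w = (if w = u then m else n)" for w
    have sum: "(\<Sum>w\<in>B. f w *s w) = 0" using that uv by (simp add: f_def)
    have "f w = 0" if "w \<in> B" for w
      using int_vec.independentD[of B B f w] B sum that uv by (auto simp: lattice_basis_def)
    then show ?thesis using uv unfolding f_def by (metis insertI1 insertI2)
  qed
  then have "basis_pair L u v" using B uv by (auto simp: basis_pair_def lattice_basis_def)
  then show ?thesis by (rule that)
qed

text \<open>This is the subtractive Euclidean algorithm: while both \<open>i\<close>-th entries are
  non-zero, adding or subtracting the vector with the smaller one lowers the sum of their absolute
  values.\<close>

lemma basis_pair_zero_entry:
  assumes "basis_pair L u v"
  shows "\<exists>p q. basis_pair L p q \<and> p $ i = 0"
  using assms
proof (induction "nat (\<bar>u $ i\<bar> + \<bar>v $ i\<bar>)" arbitrary: u v rule: less_induct)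
  case less
  have step: "\<exists>p q. basis_pair L p q \<and> p $ i = 0"
    if uv: "basis_pair L u' v'" and le: "\<bar>u' $ i\<bar> \<le> \<bar>v' $ i\<bar>" and nz: "u' $ i \<noteq> 0"
      and m: "\<bar>u' $ i\<bar> + \<bar>v' $ i\<bar> = \<bar>u $ i\<bar> + \<bar>v $ i\<bar>" for u' v'
  proof -
    \<comment> \<open>This sign makes the entries cancel: the new one has absolute value
      \<open>\<bar>v' $ i\<bar> - \<bar>u' $ i\<bar>\<close>.\<close>
    define k where "k = - (sgn (u' $ i) * sgn (v' $ i))"
    have "\<bar>(v' + k *s u') $ i\<bar> < \<bar>v' $ i\<bar>"
      using le nz by (auto simp: k_def sgn_if abs_if split: if_splits)
    then have "nat (\<bar>u' $ i\<bar> + \<bar>(v' + k *s u') $ i\<bar>) < nat (\<bar>u $ i\<bar> + \<bar>v $ i\<bar>)"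
      using m by linarith
    then show ?thesis using less.hyps basis_pair_add_multiple[OF uv] by blast
  qed
  consider "u $ i = 0" | "v $ i = 0" | "u $ i \<noteq> 0" "\<bar>u $ i\<bar> \<le> \<bar>v $ i\<bar>"
    | "v $ i \<noteq> 0" "\<bar>v $ i\<bar> \<le> \<bar>u $ i\<bar>"
    by linarith
  then show ?case
  proof cases
    case 3
    then show ?thesis using step[of u v] less.prems by simp
  next
    case 4
    then show ?thesis using step[of v u] less.prems basis_pair_commute[of L u v] by simp
  qed (use less.prems basis_pair_commute in blast)+
qed

section \<open>Sign patterns forced by positive weights, and the construction of the CB
  matrix\<close>

lemma positive_entry:
  fixes d x :: "int ^ 'n::finite"
  assumes d: "\<And>i. d $ i > 0" and dx: "(\<Sum>j\<in>UNIV. d $ j * x $ j) = 0"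
    and "x \<noteq> 0" and le: "\<And>j. j \<noteq> i \<Longrightarrow> x $ j \<le> 0"
  shows "x $ i > 0"
proof (rule ccontr)
  assume "\<not> x $ i > 0"
  \<comment> \<open>A vanishing sum of non-positive terms has only zero terms; as the weights are
    non-zero, \<open>x\<close> would be 0.\<close>
  then have "d $ j * x $ j \<le> 0" for j
    using le[of j] d[of j] by (cases "j = i") (auto simp: mult_le_0_iff)
  then have "\<forall>j. d $ j * x $ j = 0"
    using dx sum_nonneg_eq_0_iff[of UNIV "\<lambda>j. - (d $ j * x $ j)"] by (simp add: sum_negf)
  then have "x $ j = 0" for j using d[of j] by (metis less_irrefl mult_eq_0_iff)
  then show False using \<open>x \<noteq> 0\<close> by (simp add: vec_eq_iff)
qed

text \<open>A single positive entry would make the weighted sum positive. Applied to the columns,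
  this gives the non-zero off-diagonal entries of a CB matrix.\<close>

lemma nonzero_other_entry:
  fixes d x :: "int ^ 'n::finite"
  assumes d: "d $ i > 0" and dx: "(\<Sum>j\<in>UNIV. d $ j * x $ j) = 0" and x: "x $ i > 0"
  shows "\<exists>j. j \<noteq> i \<and> x $ j \<noteq> 0"
proof (rule ccontr)
  assume "\<not> ?thesis"
  then have "(\<Sum>j\<in>UNIV. d $ j * x $ j) = d $ i * x $ i"
    using sum.mono_neutral_right[of UNIV "{i}" "\<lambda>j. d $ j * x $ j"] by auto
  then show False using d x dx by simp
qed

lemma basis_pair_signs:
  fixes L :: "(int ^ 3) set" and d :: "int ^ 3"
  assumes d: "\<And>i. d $ i > 0" and dL: "\<And>a. a \<in> L \<Longrightarrow> (\<Sum>i\<in>UNIV. d $ i * a $ i) = 0"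
    and "basis_pair L u v"
  shows "\<exists>u v. basis_pair L u v \<and> u $ 2 \<le> 0 \<and> u $ 3 \<le> 0 \<and> v $ 1 \<le> 0 \<and> v $ 3 \<le> 0"
proof -
  have neg: "\<exists>y. (y = x \<or> y = - x) \<and> y $ i \<le> 0" for x :: "int ^ 3" and i
    by (cases "x $ i \<le> 0") (auto intro: exI[of _ "- x"])
  obtain p0 q0 where pq0: "basis_pair L p0 q0" "p0 $ 3 = 0"
    using basis_pair_zero_entry[OF assms(3)] by blast
  \<comment> \<open>The third entry stays 0 under either sign, so the sign of \<open>p\<close> is
    free to fix the second entry.\<close>
  obtain p where p0: "p = p0 \<or> p = - p0" and "p $ 2 \<le> 0" using neg by blast
  with pq0(2) have p: "p $ 3 = 0" "p $ 2 \<le> 0" by auto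
  obtain q where q0: "q = q0 \<or> q = - q0" and q: "q $ 3 \<le> 0" using neg by blast
  have "basis_pair L p q0" using pq0(1) p0 basis_pair_uminus by blast
  then have "basis_pair L q0 p" by (rule basis_pair_commute[THEN iffD1])
  then have "basis_pair L q p" using q0 basis_pair_uminus by blast
  then have pq: "basis_pair L p q" by (rule basis_pair_commute[THEN iffD1])
  have "p $ 1 > 0"
  proof (rule positive_entry[OF d dL])
    show "p \<in> L" "p \<noteq> 0" using basis_pair_mem[OF pq] basis_pair_nonzero[OF pq] by auto
    show "p $ j \<le> 0" if "j \<noteq> 1" for j using p exhaust_3[of j] that by auto
  qed
  \<comment> \<open>Since \<open>p $ 1 \<ge> 1\<close>, subtracting \<open>\<bar>q $ 1\<bar>\<close>
    copies of \<open>p\<close> makes the first entry non-positive; since \<open>p $ 3 = 0\<close>,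
    the third entry remains that of \<open>q\<close>.\<close>
  define v where "v = q + (- \<bar>q $ 1\<bar>) *s p"
  have "\<bar>q $ 1\<bar> * 1 \<le> \<bar>q $ 1\<bar> * p $ 1" using \<open>p $ 1 > 0\<close> by (intro mult_left_mono) auto
  then have "v $ 1 \<le> 0" by (simp add: v_def)
  moreover have "v $ 3 \<le> 0" using p q by (simp add: v_def)
  moreover have "basis_pair L p v" unfolding v_def by (rule basis_pair_add_multiple[OF pq])
  ultimately show ?thesis using p by (intro exI[of _ p] exI[of _ v]) auto
qed

text \<open>Both terms of the induction measure are non-negative. If
  \<open>u $ 1 + v $ 1 < 0\<close>, passing from \<open>v\<close> to \<open>u + v\<close> adds the
  positive number \<open>u $ 1\<close> to a first entry that stays negative, so the measure drops;
  the other case is symmetric. Third entries stay non-positive under addition.\<close>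

lemma basis_pair_reduced:
  fixes L :: "(int ^ 3) set" and d :: "int ^ 3"
  assumes d: "\<And>i. d $ i > 0" and dL: "\<And>a. a \<in> L \<Longrightarrow> (\<Sum>i\<in>UNIV. d $ i * a $ i) = 0"
    and "basis_pair L u v" "u $ 2 \<le> 0" "u $ 3 \<le> 0" "v $ 1 \<le> 0" "v $ 3 \<le> 0"
  shows "\<exists>u v. basis_pair L u v \<and> u $ 2 \<le> 0 \<and> u $ 3 \<le> 0 \<and> v $ 1 \<le> 0 \<and> v $ 3 \<le> 0 \<and>
    u $ 1 + v $ 1 \<ge> 0 \<and> u $ 2 + v $ 2 \<ge> 0"
  using assms(3-)
proof (induction "nat (- (u $ 2) - v $ 1)" arbitrary: u v rule: less_induct)
  case less
  note uv = less.prems(1) and signs = less.prems(2-)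
  have "u $ 1 > 0"
  proof (rule positive_entry[OF d dL])
    show "u \<in> L" "u \<noteq> 0" using basis_pair_mem[OF uv] basis_pair_nonzero[OF uv] by auto
    show "u $ j \<le> 0" if "j \<noteq> 1" for j using signs exhaust_3[of j] that by auto
  qed
  have "v $ 2 > 0"
  proof (rule positive_entry[OF d dL])
    show "v \<in> L" "v \<noteq> 0" using basis_pair_mem[OF uv] basis_pair_nonzero[OF uv] by auto
    show "v $ j \<le> 0" if "j \<noteq> 2" for j using signs exhaust_3[of j] that by auto
  qed
  consider "u $ 1 + v $ 1 < 0" | "u $ 2 + v $ 2 < 0" | "u $ 1 + v $ 1 \<ge> 0" "u $ 2 + v $ 2 \<ge> 0"
    by linarith
  then show ?case
  proof cases
    case 1
    then show ?thesis
      using less.hyps[of u "u + v"] basis_pair_add[OF uv] signs \<open>u $ 1 > 0\<close> by simp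
  next
    case 2
    then show ?thesis
      using less.hyps[of "u + v" v] basis_pair_add[OF uv] signs \<open>v $ 2 > 0\<close> by simp
  next
    case 3
    then show ?thesis using uv signs by blast
  qed
qed

lemma CB_matrix_of_reduced_basis_pair:
  fixes L :: "(int ^ 3) set" and d :: "int ^ 3"
  assumes d: "\<And>i. d $ i > 0" and dL: "\<And>a. a \<in> L \<Longrightarrow> (\<Sum>i\<in>UNIV. d $ i * a $ i) = 0"
    and uv: "basis_pair L u v"
    and signs: "u $ 2 \<le> 0" "u $ 3 \<le> 0" "v $ 1 \<le> 0" "v $ 3 \<le> 0"
      "u $ 1 + v $ 1 \<ge> 0" "u $ 2 + v $ 2 \<ge> 0"
  shows "\<exists>A :: int ^ 3 ^ 3. CB_matrix A \<and> L = group_closure (columns A)"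
proof -
  \<comment> \<open>This third column makes the row sums vanish without enlarging the generated
    subgroup. The last two sign hypotheses say that its first two entries are non-positive.\<close>
  define w where "w = - (u + v)"
  \<comment> \<open>The basis vectors are the rows of \<open>R\<close>, so that \<open>R $ i\<close>
    selects a lattice vector; the CB matrix is the transpose.\<close>
  define R :: "int ^ 3 ^ 3" where "R = vector [u, v, w]"
  have R: "R $ 1 = u" "R $ 2 = v" "R $ 3 = w" by (simp_all add: R_def)
  have "w \<in> L"
    using basis_pair_mem(3)[OF uv] uv unfolding w_def basis_pair_def by (metis group_closure_minus_iff)
  then have mem: "R $ i \<in> L" for i
    using basis_pair_mem[OF uv] exhaust_3[of i] R by auto
  have nonzero: "R $ i \<noteq> 0" for i
    using basis_pair_nonzero[OF uv] exhaust_3[of i] R by (auto simp: w_def add_eq_0_iff)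
  have off: "R $ i $ j \<le> 0" if "i \<noteq> j" for i j
    using that signs exhaust_3[of i] exhaust_3[of j] R by (auto simp: w_def)
  have diag: "R $ i $ i > 0" for i
    by (rule positive_entry[OF d dL[OF mem] nonzero]) (rule off, simp)
  have "transpose R *v 1 = 0"
    by (simp add: vec_eq_iff matrix_vector_mult_def transpose_def sum_3 R w_def)
  moreover have "\<exists>j. j \<noteq> i \<and> R $ i $ j \<noteq> 0" for i
    using nonzero_other_entry[OF d dL[OF mem[of i]] diag[of i]] .
  ultimately have "CB_matrix (transpose R)"
    using off diag by (simp add: CB_matrix_def transpose_def)
  moreover have "columns (transpose R) = {u, v, w}"
    by (auto simp: rows_def row_def R UNIV_3 intro: exI[of _ 1] exI[of _ 2] exI[of _ 3])
  moreover have "group_closure {u, v, w} = L"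
  proof
    have "{u, v, w} \<subseteq> L" using basis_pair_mem[OF uv] \<open>w \<in> L\<close> by simp
    then show "group_closure {u, v, w} \<subseteq> L"
      using group_closure_subset uv unfolding basis_pair_def by blast
    have "group_closure {u, v} \<subseteq> group_closure {u, v, w}"
      by (rule group_closure_subset) (auto intro: group_closure.base)
    then show "L \<subseteq> group_closure {u, v, w}" using uv unfolding basis_pair_def by simp
  qed
  ultimately show ?thesis by metis
qed

section \<open>A positive vector in the left kernel of a CB matrix\<close>

lemma CB_matrix_left_kernel:
  fixes A :: "int ^ 3 ^ 3"
  assumes "CB_matrix A"
  obtains d :: "int ^ 3" where "\<And>i. d $ i > 0"
    and "\<And>j. (\<Sum>i\<in>UNIV. d $ i * A $ i $ j) = 0"
proof -
  \<comment> \<open>For distinct \<open>i\<close> and \<open>j\<close>, \<open>x i j\<close> is the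
    weight of the arc from \<open>i\<close> to \<open>j\<close>. The positive diagonal gives every
    vertex an outgoing arc of positive weight (\<open>row_pos\<close>), the column condition an
    incoming one (\<open>col_pos\<close>).\<close>
  define x where "x i j = - (A $ i $ j)" for i j
  have rows: "A $ 1 $ 1 = x 1 2 + x 1 3" "A $ 2 $ 2 = x 2 1 + x 2 3" "A $ 3 $ 3 = x 3 1 + x 3 2"
    using assms by (auto simp: CB_matrix_def vec_eq_iff matrix_vector_mult_def sum_3 forall_3 x_def)
  have off: "A $ i $ j = - x i j" for i j by (simp add: x_def)
  have nonneg: "x 1 2 \<ge> 0" "x 1 3 \<ge> 0" "x 2 1 \<ge> 0" "x 2 3 \<ge> 0" "x 3 1 \<ge> 0" "x 3 2 \<ge> 0"
    using assms by (auto simp: CB_matrix_def x_def)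
  have row_pos: "x 1 2 + x 1 3 > 0" "x 2 1 + x 2 3 > 0" "x 3 1 + x 3 2 > 0"
    using assms rows by (auto simp: CB_matrix_def simp flip: rows)
  have col: "\<exists>i. i \<noteq> j \<and> x i j \<noteq> 0" for j
    using assms by (auto simp: CB_matrix_def x_def)
  have col_pos: "x 2 1 > 0 \<or> x 3 1 > 0" "x 1 2 > 0 \<or> x 3 2 > 0" "x 1 3 > 0 \<or> x 2 3 > 0"
    using col[of 1] col[of 2] col[of 3] nonneg by (metis exhaust_3 order_le_less)+
  \<comment> \<open>the spanning-tree sums, that is, the diagonal cofactors of \<open>A\<close>\<close>
  define d :: "int ^ 3" where "d = vector
    [x 2 1 * x 3 1 + x 2 1 * x 3 2 + x 3 1 * x 2 3,
     x 1 2 * x 3 2 + x 1 2 * x 3 1 + x 3 2 * x 1 3,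
     x 1 3 * x 2 3 + x 1 3 * x 2 1 + x 2 3 * x 1 2]"
  \<comment> \<open>Here \<open>a\<close> and \<open>b\<close> are the weights of the arcs into the
    root from the other two vertices, \<open>e\<close> and \<open>f\<close> those between these two.
    Each factorization exhibits a positive product, the first if \<open>a > 0\<close> and the second
    if \<open>b > 0\<close>.\<close>
  have pos: "a * b + a * e + b * f > 0"
    if "a \<ge> 0" "b \<ge> 0" "e \<ge> 0" "f \<ge> 0" "a + f > 0" "b + e > 0" "a > 0 \<or> b > 0" for a b e f :: int
  proof -
    have "a * b + a * e + b * f = a * (b + e) + b * f" "a * b + a * e + b * f = b * (a + f) + a * e"
      by algebra+
    then show ?thesis using that by (metis add_pos_nonneg mult_nonneg_nonneg mult_pos_pos)
  qed
  have "d $ 1 > 0" "d $ 2 > 0" "d $ 3 > 0"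
    using pos[of "x 2 1" "x 3 1" "x 3 2" "x 2 3"] pos[of "x 1 2" "x 3 2" "x 3 1" "x 1 3"]
      pos[of "x 1 3" "x 2 3" "x 2 1" "x 1 2"] nonneg row_pos col_pos
    by (simp_all add: d_def add.commute)
  then have "d $ i > 0" for i using exhaust_3[of i] by auto
  moreover have "(\<Sum>i\<in>UNIV. d $ i * A $ i $ j) = 0" for j
  proof -
    \<comment> \<open>Only off-diagonal instances of \<open>off\<close> are unfolded, so that the
      diagonal entries become sums of weights through \<open>rows\<close>; each column is then a
      polynomial identity.\<close>
    have "(\<Sum>i\<in>UNIV. d $ i * A $ i $ 1) = 0" "(\<Sum>i\<in>UNIV. d $ i * A $ i $ 2) = 0"
      "(\<Sum>i\<in>UNIV. d $ i * A $ i $ 3) = 0"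
      unfolding sum_3 rows off[of 1 2] off[of 1 3] off[of 2 1] off[of 2 3] off[of 3 1] off[of 3 2]
      by (simp_all add: d_def algebra_simps)
    then show ?thesis using exhaust_3[of j] by auto
  qed
  ultimately show ?thesis by (rule that)
qed

lemma homogeneous_lattice_group_closure:
  fixes d :: "int ^ 'n::finite"
  assumes "\<And>i. d $ i > 0" and "\<And>a. a \<in> S \<Longrightarrow> (\<Sum>i\<in>UNIV. d $ i * a $ i) = 0"
  shows "homogeneous_lattice (group_closure S)"
proof -
  have "(\<Sum>i\<in>UNIV. d $ i * a $ i) = 0" if "a \<in> group_closure S" for a
    using that
    by induction (use assms(2) in \<open>auto simp: right_diff_distrib sum_subtractf\<close>)
  then show ?thesis using assms(1) by (auto simp: homogeneous_lattice_def)
qed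

theorem corollary8p7:
  fixes L :: "(int ^ 3) set"
  assumes "lattice_in L" and "lattice_rank L = 2"
  shows "homogeneous_lattice L \<longleftrightarrow>
    (\<exists>A :: int ^ 3 ^ 3. CB_matrix A \<and> L = group_closure (columns A))"
proof
  assume "homogeneous_lattice L"
  then obtain d :: "int ^ 3" where d: "\<And>i. d $ i > 0"
    and dL: "\<And>a. a \<in> L \<Longrightarrow> (\<Sum>i\<in>UNIV. d $ i * a $ i) = 0"
    by (auto simp: homogeneous_lattice_def)
  obtain u v where "basis_pair L u v" using lattice_rank_2_basis_pair[OF assms(2)] .
  then show "\<exists>A :: int ^ 3 ^ 3. CB_matrix A \<and> L = group_closure (columns A)"
    using basis_pair_signs[OF d dL] basis_pair_reduced[OF d dL]
      CB_matrix_of_reduced_basis_pair[OF d dL] by metis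
next
  assume "\<exists>A :: int ^ 3 ^ 3. CB_matrix A \<and> L = group_closure (columns A)"
  then obtain A :: "int ^ 3 ^ 3" where A: "CB_matrix A" "L = group_closure (columns A)" by blast
  obtain d :: "int ^ 3" where d: "\<And>i. d $ i > 0" "\<And>j. (\<Sum>i\<in>UNIV. d $ i * A $ i $ j) = 0"
    using CB_matrix_left_kernel[OF A(1)] by blast
  \<comment> \<open>Orthogonality to \<open>d\<close> is checked on the generators, where it is the
    left kernel condition.\<close>
  have "(\<Sum>i\<in>UNIV. d $ i * a $ i) = 0" if "a \<in> columns A" for a
    using that d(2) by (auto simp: columns_def column_def)
  then show "homogeneous_lattice L"
    using homogeneous_lattice_group_closure[OF d(1)] A(2) by blast
qed

end
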